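(* Let $K$ be a field, let $P=K[x_1,\dots,x_n]$, let $X=(x_1,\dots,x_n)$, let $\mathfrak{M}=\langle x_1,\dots,x_n\rangle$, and let $I$ be an ideal of $P$ with $I\subseteq \mathfrak{M}$. Suppose that $I$ is $Z$-separating for some tuple $Z=(z_1,\dots,z_s)$ of pairwise distinct indeterminates in $X$ (with $1\le s\le n$), let $\sigma$ be a $Z$-separating term ordering for $I$, and let $Y=X\setminus Z$. Then the following hold. (a) We have $\langle Z\rangle\subseteq \mathrm{LT}_\sigma(\langle \mathrm{Lin}_{\mathfrak{M}}(I)\rangle)$. (b) Let $S_\sigma$ be the (minimal) set of indeterminates which generates $\mathrm{LT}_\sigma(\langle \mathrm{Lin}_{\mathfrak{M}}(I)\rangle)$. Then $Y\supseteq X\setminus S_\sigma$. (c) We have $Z\subseteq \mathrm{LT}_\tau(\langle \mathrm{Lin}_{\mathfrak{M}}(I)\rangle)$ for every elimination ordering $\tau$ for $Z$.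
   Context: $\mathrm{LT}_\sigma(J)$ denotes the leading term ideal of an ideal $J$ with respect to a term ordering $\sigma$ on the terms $\mathbb{T}^n$ of $P$. Tuples of distinct indeterminates are identified with sets when writing $X\setminus Z$, $Z\subseteq\cdots$, etc. A term ordering $\tau$ is an elimination ordering for $Z$ if every $f\in P\setminus\{0\}$ whose leading term $\mathrm{LT}_\tau(f)$ involves no indeterminate of $Z$ lies in $K[Y]$. The ideal $I\subseteq\mathfrak{M}$ is $Z$-separating if there exist a term ordering $\sigma$ and $f_1,\dots,f_s\in I\setminus\{0\}$ with $\mathrm{LT}_\sigma(f_i)=z_i$ for $i=1,\dots,s$; such a $\sigma$ is called a $Z$-separating term ordering for $I$. For $f\in\mathfrak{M}$, $\mathrm{Lin}_{\mathfrak{M}}(f)$ denotes the homogeneous component of $f$ of standard degree $1$, and $\mathrm{Lin}_{\mathfrak{M}}(I)=\langle \mathrm{Lin}_{\mathfrak{M}}(f)\mid f\in I\rangle_K$ is the $K$-vector space of linear parts of $I$; $\langle\mathrm{Lin}_{\mathfrak{M}}(I)\rangle$ is the ideal of $P$ it generates. (The leading term ideal of an ideal generated by linear forms is generated by indeterminates.) *)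

theory Defs
  imports Complex_Main "HOL-Library.Cardinality" "HOL-Library.Poly_Mapping"
begin

text \<open>
  The indeterminates are indexed by a finite type \<open>'x\<close>, so that \<open>n = CARD('x)\<close>.
  Terms are exponent vectors, written additively: the product of two terms is \<open>s + t\<close>
  and the term \<open>1\<close> is \<open>0\<close>.
\<close>

type_synonym 'x pterm = "'x \<Rightarrow>\<^sub>0 nat"
type_synonym ('x, 'k) mpoly = "'x pterm \<Rightarrow>\<^sub>0 'k"

definition indet_term :: "'x \<Rightarrow> 'x pterm" where
  "indet_term x = Poly_Mapping.single x 1"

definition monomial :: "'x pterm \<Rightarrow> ('x, 'k::field) mpoly" where
  "monomial t = Poly_Mapping.single t 1"

definition indet :: "'x \<Rightarrow> ('x, 'k::field) mpoly" where
  "indet x = monomial (indet_term x)"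

definition const :: "'k::field \<Rightarrow> ('x, 'k) mpoly" where
  "const c = Poly_Mapping.single 0 c"

text \<open>
  Ideals of \<open>P\<close> are the submodules of \<open>P\<close> over itself; \<open>K\<close>-subspaces are the submodules
  for the scalar multiplication by constants.
\<close>

global_interpretation P_mod: module "(*) :: ('x, 'k::field) mpoly \<Rightarrow> ('x, 'k) mpoly \<Rightarrow> ('x, 'k) mpoly"
  by unfold_locales (simp_all add: algebra_simps)

global_interpretation K_vs: vector_space "\<lambda>(c::'k::field) (f::('x, 'k) mpoly). const c * f"
proof unfold_locales
  show "const (a + b) * x = const a * x + const b * x" for a b :: 'k and x :: "('x, 'k) mpoly"
    by (simp add: const_def single_add distrib_right)
  show "const a * (const b * x) = const (a * b) * x" for a b :: 'k and x :: "('x, 'k) mpoly"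
  proof -
    have "const (a * b) = const a * (const b :: ('x, 'k) mpoly)"
      by (simp add: const_def mult_single)
    then show ?thesis by (simp only: mult.assoc)
  qed
  show "const 1 * x = x" for x :: "('x, 'k) mpoly"
    by (simp add: const_def)
qed (rule distrib_left)

abbreviation is_ideal :: "('x, 'k::field) mpoly set \<Rightarrow> bool" where
  "is_ideal \<equiv> P_mod.subspace"

abbreviation ideal_gen :: "('x, 'k::field) mpoly set \<Rightarrow> ('x, 'k) mpoly set" where
  "ideal_gen \<equiv> P_mod.span"

definition max_ideal :: "('x, 'k::field) mpoly set" where
  "max_ideal = ideal_gen (range indet)"

definition poly_subring :: "'x set \<Rightarrow> ('x, 'k::field) mpoly set" where
  "poly_subring Y = {f. \<forall>t\<in>Poly_Mapping.keys f. Poly_Mapping.keys t \<subseteq> Y}"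

definition term_degree :: "'x pterm \<Rightarrow> nat" where
  "term_degree t = (\<Sum>x\<in>Poly_Mapping.keys t. Poly_Mapping.lookup t x)"

definition hom_component :: "nat \<Rightarrow> ('x, 'k::field) mpoly \<Rightarrow> ('x, 'k) mpoly" where
  "hom_component d f =
     (\<Sum>t\<in>{t\<in>Poly_Mapping.keys f. term_degree t = d}.
        Poly_Mapping.single t (Poly_Mapping.lookup f t))"

definition Lin :: "('x, 'k::field) mpoly \<Rightarrow> ('x, 'k) mpoly" where
  "Lin f = hom_component 1 f"

definition Lin_space :: "('x, 'k::field) mpoly set \<Rightarrow> ('x, 'k) mpoly set" where
  "Lin_space J = K_vs.span (Lin ` J)"

text \<open>A term ordering is given by its non-strict relation: \<open>le s t\<close> means \<open>s \<le> t\<close>.\<close>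

definition term_ordering :: "('x pterm \<Rightarrow> 'x pterm \<Rightarrow> bool) \<Rightarrow> bool" where
  "term_ordering le \<longleftrightarrow>
     reflp le \<and> transp le \<and> antisymp le \<and> totalp le \<and>
     (\<forall>s t u. le s t \<longrightarrow> le (s + u) (t + u)) \<and>
     (\<forall>t. le 0 t)"

text \<open>Only meaningful for nonzero \<open>f\<close>.\<close>

definition lead_term :: "('x pterm \<Rightarrow> 'x pterm \<Rightarrow> bool) \<Rightarrow> ('x, 'k::field) mpoly \<Rightarrow> 'x pterm" where
  "lead_term le f =
     (THE t. t \<in> Poly_Mapping.keys f \<and> (\<forall>u\<in>Poly_Mapping.keys f. le u t))"

definition LT_ideal ::
  "('x pterm \<Rightarrow> 'x pterm \<Rightarrow> bool) \<Rightarrow> ('x, 'k::field) mpoly set \<Rightarrow> ('x, 'k) mpoly set" where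
  "LT_ideal le J = ideal_gen {monomial (lead_term le f) | f. f \<in> J \<and> f \<noteq> 0}"

definition separating_term_ordering ::
  "'x list \<Rightarrow> ('x, 'k::field) mpoly set \<Rightarrow> ('x pterm \<Rightarrow> 'x pterm \<Rightarrow> bool) \<Rightarrow> bool" where
  "separating_term_ordering Z I le \<longleftrightarrow>
     term_ordering le \<and>
     (\<exists>f :: nat \<Rightarrow> ('x, 'k) mpoly. \<forall>i<length Z.
        f i \<in> I - {0} \<and> lead_term le (f i) = indet_term (Z ! i))"

definition separating :: "'x list \<Rightarrow> ('x, 'k::field) mpoly set \<Rightarrow> bool" where
  "separating Z I \<longleftrightarrow> (\<exists>le. separating_term_ordering Z I le)"

text \<open>
  The type argument fixes the coefficient field \<open>K\<close>, which does not occur in the type of the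
  ordering. With \<open>Y = X - Z\<close>, \<open>K[Y]\<close> is \<open>poly_subring (- Z)\<close>.
\<close>

definition elimination_ordering ::
  "'k::field itself \<Rightarrow> 'x set \<Rightarrow> ('x pterm \<Rightarrow> 'x pterm \<Rightarrow> bool) \<Rightarrow> bool" where
  "elimination_ordering _ Z le \<longleftrightarrow>
     term_ordering le \<and>
     (\<forall>f :: ('x, 'k) mpoly. f \<noteq> 0 \<longrightarrow>
        Poly_Mapping.keys (lead_term le f) \<inter> Z = {} \<longrightarrow> f \<in> poly_subring (- Z))"

definition minimal_indet_generators :: "'x set \<Rightarrow> ('x, 'k::field) mpoly set \<Rightarrow> bool" where
  "minimal_indet_generators S J \<longleftrightarrow>
     ideal_gen (indet ` S) = J \<and> (\<forall>S'. S' \<subset> S \<longrightarrow> ideal_gen (indet ` S') \<noteq> J)"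

end

theory Submission
  imports Defs
begin

text \<open>
  Each separating polynomial \<open>f\<^sub>i\<close> contains its leading term \<open>z\<^sub>i\<close> as a linear term, so
  \<open>Lin f\<^sub>i\<close> still has leading term \<open>z\<^sub>i\<close>; this gives (a). For (c), the matrix of the
  coefficients of \<open>z\<^sub>j\<close> in \<open>Lin f\<^sub>i\<close> is triangular with respect to the order that \<open>\<sigma>\<close> induces
  on \<open>Z\<close>, so Gaussian elimination yields, for every \<open>z \<in> Z\<close>, a linear form in the span that
  involves no element of \<open>Z\<close> except \<open>z\<close>. An elimination ordering for \<open>Z\<close> must choose \<open>z\<close> as
  its leading term.
\<close>

section \<open>Terms of degree one and linear parts\<close>

lemma indet_term_inj [simp]: "indet_term x = indet_term y \<longleftrightarrow> x = y"
proof
  assume "indet_term x = indet_term y"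
  then have "Poly_Mapping.lookup (indet_term x) x = Poly_Mapping.lookup (indet_term y) x" by simp
  then show "x = y" by (simp add: indet_term_def lookup_single when_def split: if_splits)
qed simp

lemma keys_indet_term [simp]: "Poly_Mapping.keys (indet_term x) = {x}"
  by (simp add: indet_term_def)

lemma keys_indet [simp]:
  "Poly_Mapping.keys (indet x :: ('x, 'k::field) mpoly) = {indet_term x}"
  by (simp add: indet_def monomial_def)

lemma term_degree_indet_term [simp]: "term_degree (indet_term x) = 1"
  by (simp add: term_degree_def) (simp add: indet_term_def)

text \<open>Exponents are natural numbers, so a total of 1 leaves a single exponent equal to 1 and
  all others 0. Hence linear parts involve indeterminates only.\<close>

lemma term_degree_eq_1:
  assumes "term_degree t = 1"
  shows "t \<in> range indet_term"
proof -
  let ?l = "Poly_Mapping.lookup t"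
  from assms have "sum ?l (Poly_Mapping.keys t) = Suc 0"
    by (simp add: term_degree_def)
  then obtain x where x: "x \<in> Poly_Mapping.keys t" "?l x = Suc 0"
    "\<forall>y\<in>Poly_Mapping.keys t. x \<noteq> y \<longrightarrow> ?l y = 0"
    by (auto simp: sum_eq_Suc0_iff)
  have "t = indet_term x"
  proof (rule poly_mapping_eqI)
    fix y
    show "?l y = Poly_Mapping.lookup (indet_term x) y"
      using x by (auto simp: indet_term_def lookup_single when_def in_keys_iff)
  qed
  then show ?thesis by simp
qed

lemma lookup_Lin:
  "Poly_Mapping.lookup (Lin f) t = (Poly_Mapping.lookup f t when term_degree t = 1)"
proof -
  let ?A = "{s \<in> Poly_Mapping.keys f. term_degree s = 1}"
  have "Poly_Mapping.lookup (Lin f) t = (\<Sum>s\<in>?A. Poly_Mapping.lookup f s when s = t)"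
    by (simp add: Lin_def hom_component_def lookup_sum lookup_single)
  also have "\<dots> = (\<Sum>s\<in>?A. if t = s then Poly_Mapping.lookup f s else 0)"
    by (rule sum.cong) (auto simp: when_def)
  also have "\<dots> = (Poly_Mapping.lookup f t when term_degree t = 1)"
    by (simp add: sum.delta' when_def in_keys_iff)
  finally show ?thesis .
qed

lemma keys_Lin: "Poly_Mapping.keys (Lin f) = {t \<in> Poly_Mapping.keys f. term_degree t = 1}"
  by (auto simp: in_keys_iff lookup_Lin when_def split: if_splits)

lemma keys_Lin_subset: "Poly_Mapping.keys (Lin f) \<subseteq> range indet_term"
  using term_degree_eq_1 by (auto simp: keys_Lin)

lemma lookup_const_mult:
  "Poly_Mapping.lookup (const c * f) t = c * Poly_Mapping.lookup f t"
  unfolding const_def mult_map_scale_conv_mult [symmetric]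
  by (simp add: map.rep_eq when_def)

section \<open>Leading terms\<close>

lemma lead_term_eqI:
  assumes "term_ordering le" and "t \<in> Poly_Mapping.keys f"
    and "\<And>u. u \<in> Poly_Mapping.keys f \<Longrightarrow> le u t"
  shows "lead_term le f = t"
  unfolding lead_term_def
  using assms by (intro the_equality) (auto simp: term_ordering_def dest: antisympD)

text \<open>The finite nonempty support has a greatest element because the ordering is transitive
  and total; with uniqueness from antisymmetry, the definite description in \<open>lead_term\<close>
  denotes it.\<close>

lemma lead_term:
  assumes le: "term_ordering le" and "f \<noteq> 0"
  shows lead_term_in_keys: "lead_term le f \<in> Poly_Mapping.keys f"
    and lead_term_max: "u \<in> Poly_Mapping.keys f \<Longrightarrow> le u (lead_term le f)"
proof -
  have "reflp le" "transp le" "totalp le"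
    using le by (simp_all add: term_ordering_def)
  obtain t where t: "t \<in> Poly_Mapping.keys f" "\<forall>u\<in>Poly_Mapping.keys f. u \<noteq> t \<longrightarrow> le u t"
    using Finite_Set.bex_greatest_element [of "Poly_Mapping.keys f" le] \<open>f \<noteq> 0\<close>
      \<open>transp le\<close> \<open>totalp le\<close>
    by (auto intro: transp_on_subset totalp_on_subset)
  have max: "le u t" if "u \<in> Poly_Mapping.keys f" for u
    using t that \<open>reflp le\<close> by (cases "u = t") (auto dest: reflpD)
  have "lead_term le f = t"
    using le t(1) max by (rule lead_term_eqI)
  with t(1) max show "lead_term le f \<in> Poly_Mapping.keys f"
    and "u \<in> Poly_Mapping.keys f \<Longrightarrow> le u (lead_term le f)"
    by simp_all
qed

text \<open>Passing to the linear part only discards terms. The term of \<open>z\<close> has degree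
  1, so it survives, and it remains the greatest among the fewer terms left.\<close>

lemma lead_term_Lin:
  assumes "term_ordering le" and "f \<noteq> 0" and "lead_term le f = indet_term z"
  shows "indet_term z \<in> Poly_Mapping.keys (Lin f)"
    and "lead_term le (Lin f) = indet_term z"
proof -
  show "indet_term z \<in> Poly_Mapping.keys (Lin f)"
    using lead_term_in_keys [OF assms(1,2)] assms(3) by (simp add: keys_Lin)
  then show "lead_term le (Lin f) = indet_term z"
    using lead_term_max [OF assms(1,2)] assms(3)
    by (intro lead_term_eqI assms(1)) (auto simp: keys_Lin)
qed

section \<open>Indeterminates in leading term ideals and in ideals generated by
  indeterminates\<close>

lemma indet_in_LT_ideal:
  assumes "f \<in> J" and "f \<noteq> 0" and "lead_term le f = indet_term z"
  shows "indet z \<in> LT_ideal le J"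
  unfolding LT_ideal_def indet_def
  using assms by (intro P_mod.span_base) force

text \<open>The polynomials all of whose terms involve an element of \<open>S\<close> form an ideal,
  and this ideal contains the generators.\<close>

lemma keys_ideal_gen_indets:
  assumes "f \<in> ideal_gen (indet ` S)" and "t \<in> Poly_Mapping.keys f"
  shows "Poly_Mapping.keys t \<inter> S \<noteq> {}"
proof -
  let ?Q = "{f :: ('a, 'b) mpoly. \<forall>t\<in>Poly_Mapping.keys f. Poly_Mapping.keys t \<inter> S \<noteq> {}}"
  have "is_ideal ?Q"
  proof (rule P_mod.subspaceI)
    show "f + g \<in> ?Q" if "f \<in> ?Q" "g \<in> ?Q" for f g
      using that keys_add [of f g] by blast
    show "c * f \<in> ?Q" if "f \<in> ?Q" for c f
    proof (rule CollectI, rule ballI)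
      fix t assume "t \<in> Poly_Mapping.keys (c * f)"
      then obtain a b where b: "t = a + b" "b \<in> Poly_Mapping.keys f"
        using keys_mult [of c f] by blast
      \<comment> \<open>Exponents add without cancellation, so a multiple of a term involves every
        indeterminate of that term.\<close>
      then have "Poly_Mapping.keys b \<subseteq> Poly_Mapping.keys t"
        by (auto simp: in_keys_iff lookup_add)
      then show "Poly_Mapping.keys t \<inter> S \<noteq> {}"
        using that b(2) by blast
    qed
  qed simp
  moreover have "indet ` S \<subseteq> ?Q" by auto
  ultimately have "ideal_gen (indet ` S) \<subseteq> ?Q"
    by (rule P_mod.span_minimal [rotated])
  with assms show ?thesis by blast
qed

lemma indet_in_ideal_gen_indets_iff:
  "(indet x :: ('x, 'k::field) mpoly) \<in> ideal_gen (indet ` S) \<longleftrightarrow> x \<in> S"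
  using keys_ideal_gen_indets [of "indet x :: ('x, 'k) mpoly" S "indet_term x"]
  by (auto intro: P_mod.span_base)

section \<open>Gaussian elimination and elimination orderings\<close>

lemma reduced_linear_form:
  fixes V :: "('x, 'k::field) mpoly set"
  assumes V: "K_vs.subspace V" and "finite Z" and le: "term_ordering le"
    and lin: "\<And>z. z \<in> Z \<Longrightarrow> \<exists>f\<in>V. f \<noteq> 0 \<and> Poly_Mapping.keys f \<subseteq> range indet_term \<and>
      lead_term le f = indet_term z"
    and "z \<in> Z"
  shows "\<exists>g\<in>V. indet_term z \<in> Poly_Mapping.keys g \<and>
    Poly_Mapping.keys g \<subseteq> indet_term ` insert z (- Z)"
    (is "?P z")
proof (rule ccontr)
  \<comment> \<open>Elimination runs upwards along the ordering, as a minimal counterexample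
    argument. The bound on the support in \<open>?P\<close> says two things at once: the polynomial
    is a linear form, and no element of \<open>Z\<close> other than the chosen one occurs in
    it.\<close>
  assume "\<not> ?P z"
  let ?R = "\<lambda>x y. le (indet_term x) (indet_term y)"
  have "transp le" "totalp le" "antisymp le"
    using le by (simp_all add: term_ordering_def)
  have "transp ?R"
    by (rule transpI) (rule transpD [OF \<open>transp le\<close>])
  moreover have "totalp ?R"
    by (rule totalpI) (simp add: totalpD [OF \<open>totalp le\<close>])
  moreover define B where "B = {y\<in>Z. \<not> ?P y}"
  moreover have "finite B" "B \<noteq> {}"
    using \<open>finite Z\<close> \<open>z \<in> Z\<close> \<open>\<not> ?P z\<close> unfolding B_def by auto
  ultimately obtain w where "w \<in> B" and least: "\<And>y. y \<in> B \<Longrightarrow> y \<noteq> w \<Longrightarrow> ?R w y"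
    using Finite_Set.bex_least_element [of B ?R]
    by (meson subset_UNIV totalp_on_subset transp_on_subset)
  then have w: "w \<in> Z" "\<not> ?P w" unfolding B_def by blast+
  obtain f where f: "f \<in> V" "f \<noteq> 0" "Poly_Mapping.keys f \<subseteq> range indet_term"
    "lead_term le f = indet_term w"
    using lin [OF w(1)] by blast
  \<comment> \<open>These are the elements of \<open>Z\<close> to be cleared from \<open>f\<close>.
    Since \<open>w\<close> leads \<open>f\<close>, they lie strictly below \<open>w\<close>, so by
    the choice of \<open>w\<close> each already has a reduced form \<open>G y\<close>.\<close>
  define D where "D = {y\<in>Z. y \<noteq> w \<and> indet_term y \<in> Poly_Mapping.keys f}"
  have "?P y" if "y \<in> D" for y
  proof (rule ccontr)
    assume "\<not> ?P y"
    with that have "?R w y"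
      by (intro least) (simp_all only: B_def D_def mem_Collect_eq not_False_eq_True simp_thms)
    moreover have "?R y w"
      using that lead_term_max [OF le f(2)] by (auto simp: D_def f(4))
    ultimately have "y = w"
      using antisympD [OF \<open>antisymp le\<close>] by force
    with that show False by (simp add: D_def)
  qed
  then obtain G where G: "\<And>y. y \<in> D \<Longrightarrow> G y \<in> V"
    "\<And>y. y \<in> D \<Longrightarrow> indet_term y \<in> Poly_Mapping.keys (G y)"
    "\<And>y. y \<in> D \<Longrightarrow> Poly_Mapping.keys (G y) \<subseteq> indet_term ` insert y (- Z)"
    by metis
  \<comment> \<open>The multiplier that cancels \<open>y\<close> in \<open>f\<close>; the pivot in
    the denominator is nonzero for \<open>y\<close> in \<open>D\<close>.\<close>
  define c where "c y = Poly_Mapping.lookup f (indet_term y) /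
    Poly_Mapping.lookup (G y) (indet_term y)" for y
  define g where "g = f - (\<Sum>y\<in>D. const (c y) * G y)"
  have lookup_g: "Poly_Mapping.lookup g t =
      Poly_Mapping.lookup f t - (\<Sum>y\<in>D. c y * Poly_Mapping.lookup (G y) t)" for t
    by (simp add: g_def lookup_minus lookup_sum lookup_const_mult)
  have lookup_G: "Poly_Mapping.lookup (G y) (indet_term x) = 0"
    if "y \<in> D" "x \<in> Z" "x \<noteq> y" for x y
    using G(3) [OF that(1)] that(2,3) by (auto simp: in_keys_iff)
  have "finite D" using \<open>finite Z\<close> by (simp add: D_def)
  have "g \<in> V"
    unfolding g_def using f(1) G(1)
    by (intro K_vs.subspace_diff K_vs.subspace_sum K_vs.subspace_scale V)
  moreover have "indet_term w \<in> Poly_Mapping.keys g"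
  proof -
    \<comment> \<open>No \<open>G y\<close> contains \<open>w\<close>, so the subtraction leaves the
      coefficient of \<open>w\<close> in \<open>f\<close> unchanged.\<close>
    have "(\<Sum>y\<in>D. c y * Poly_Mapping.lookup (G y) (indet_term w)) = 0"
      using w(1) by (intro sum.neutral) (auto simp: lookup_G D_def)
    then show ?thesis
      using lead_term_in_keys [OF le f(2)] by (simp add: in_keys_iff lookup_g f(4))
  qed
  moreover have "Poly_Mapping.keys g \<subseteq> indet_term ` insert w (- Z)"
  proof
    fix t assume t: "t \<in> Poly_Mapping.keys g"
    have "t \<in> range indet_term"
    proof (rule ccontr)
      assume "t \<notin> range indet_term"
      then have "t \<notin> Poly_Mapping.keys (G y)" if "y \<in> D" for y
        using G(3) [OF that] by blast
      moreover have "t \<notin> Poly_Mapping.keys f"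
        using f(3) \<open>t \<notin> range indet_term\<close> by blast
      ultimately have "Poly_Mapping.lookup g t = 0"
        by (simp add: in_keys_iff lookup_g)
      with t show False by (simp add: in_keys_iff)
    qed
    then obtain x where x: "t = indet_term x" by blast
    have "x = w" if "x \<in> Z"
    proof (rule ccontr)
      assume "x \<noteq> w"
      \<comment> \<open>Among the reduced forms only \<open>G x\<close> can contain
        \<open>x\<close>. If \<open>x\<close> is in \<open>D\<close>, its multiple contributes
        exactly the coefficient of \<open>x\<close> in \<open>f\<close>; otherwise \<open>x\<close>
        does not occur in \<open>f\<close> and both sides vanish.\<close>
      have "(\<Sum>y\<in>D. c y * Poly_Mapping.lookup (G y) t) =
          (\<Sum>y\<in>D. if x = y then c y * Poly_Mapping.lookup (G y) t else 0)"
        using \<open>x \<in> Z\<close> by (intro sum.cong) (auto simp: x lookup_G)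
      also have "\<dots> = Poly_Mapping.lookup f t"
        using \<open>x \<in> Z\<close> \<open>x \<noteq> w\<close> \<open>finite D\<close> G(2) [of x]
        by (auto simp: c_def x in_keys_iff D_def)
      finally have "Poly_Mapping.lookup g t = 0" by (simp add: lookup_g)
      with t show False by (simp add: in_keys_iff)
    qed
    then show "t \<in> indet_term ` insert w (- Z)" using x by blast
  qed
  ultimately have "?P w" by blast
  with w(2) show False ..
qed

text \<open>Any other leading term would be an indeterminate outside \<open>Z\<close>; the
  elimination property would then exclude \<open>z\<close> from all terms of \<open>g\<close>,
  although it occurs there.\<close>

lemma elimination_lead_term:
  fixes g :: "('x, 'k::field) mpoly"
  assumes elim: "elimination_ordering TYPE('k) Z le" and "z \<in> Z"
    and key: "indet_term z \<in> Poly_Mapping.keys g"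
    and keys: "Poly_Mapping.keys g \<subseteq> indet_term ` insert z (- Z)"
  shows "lead_term le g = indet_term z"
proof (rule ccontr)
  assume neq: "lead_term le g \<noteq> indet_term z"
  have "g \<noteq> 0" using key by auto
  then have "lead_term le g \<in> Poly_Mapping.keys g"
    using elim by (intro lead_term_in_keys) (auto simp: elimination_ordering_def)
  then have "Poly_Mapping.keys (lead_term le g) \<inter> Z = {}"
    using keys neq by auto
  then have "g \<in> poly_subring (- Z)"
    using elim \<open>g \<noteq> 0\<close> by (auto simp: elimination_ordering_def)
  with key \<open>z \<in> Z\<close> show False by (force simp: poly_subring_def)
qed

theorem proposition2p6:
  fixes I :: "('x::finite, 'k::field) mpoly set"
    and Z :: "'x list"
    and Y :: "'x set"
    and \<sigma> :: "'x pterm \<Rightarrow> 'x pterm \<Rightarrow> bool"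
  assumes "is_ideal I" and "I \<subseteq> max_ideal"
    and "distinct Z" and "1 \<le> length Z" and "length Z \<le> CARD('x)"
    and "separating Z I"
    and "separating_term_ordering Z I \<sigma>"
    and "Y = UNIV - set Z"
  shows "ideal_gen (indet ` set Z) \<subseteq> LT_ideal \<sigma> (ideal_gen (Lin_space I)) \<and>
    (\<forall>S\<^sub>\<sigma>. minimal_indet_generators S\<^sub>\<sigma> (LT_ideal \<sigma> (ideal_gen (Lin_space I)))
       \<longrightarrow> UNIV - S\<^sub>\<sigma> \<subseteq> Y) \<and>
    (\<forall>\<tau>. elimination_ordering TYPE('k) (set Z) \<tau>
       \<longrightarrow> indet ` set Z \<subseteq> LT_ideal \<tau> (ideal_gen (Lin_space I)))"
proof -
  let ?L = "ideal_gen (Lin_space I)"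
  have \<sigma>: "term_ordering \<sigma>"
    using assms(7) by (simp add: separating_term_ordering_def)
  \<comment> \<open>The linear parts of the separating polynomials, the common source of all three
    claims.\<close>
  have lin: "\<exists>f\<in>Lin_space I. f \<noteq> 0 \<and> Poly_Mapping.keys f \<subseteq> range indet_term \<and>
      lead_term \<sigma> f = indet_term z" if z: "z \<in> set Z" for z
  proof -
    obtain i where i: "i < length Z" "z = Z ! i"
      using z by (auto simp: in_set_conv_nth)
    obtain F where "\<forall>i<length Z. F i \<in> I - {0} \<and> lead_term \<sigma> (F i) = indet_term (Z ! i)"
      using assms(7) unfolding separating_term_ordering_def by blast
    then obtain f where f: "f \<in> I" "f \<noteq> 0" "lead_term \<sigma> f = indet_term z"
      using i by blast
    have "Lin f \<in> Lin_space I"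
      using f(1) by (auto simp: Lin_space_def intro: K_vs.span_base)
    moreover have "Lin f \<noteq> 0"
      using lead_term_Lin(1) [OF \<sigma> f(2,3)] by auto
    ultimately show ?thesis
      using keys_Lin_subset lead_term_Lin(2) [OF \<sigma> f(2,3)] by blast
  qed
  have indets: "indet z \<in> LT_ideal \<sigma> ?L" if "z \<in> set Z" for z
    using lin [OF that] by (blast intro: indet_in_LT_ideal P_mod.span_base)
  have "ideal_gen (indet ` set Z) \<subseteq> LT_ideal \<sigma> ?L"
    using indets by (intro P_mod.span_minimal) (auto simp: LT_ideal_def)
  \<comment> \<open>An indeterminate lying in an ideal generated by indeterminates is one of the
    generators. Hence \<open>S\<close> contains \<open>Z\<close>, and taking complements gives
    (b).\<close>
  moreover have "UNIV - S \<subseteq> Y" if "minimal_indet_generators S (LT_ideal \<sigma> ?L)" for S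
  proof -
    have "ideal_gen (indet ` S) = LT_ideal \<sigma> ?L"
      using that by (simp add: minimal_indet_generators_def)
    then have "z \<in> S" if "z \<in> set Z" for z
      using indets [OF that] indet_in_ideal_gen_indets_iff [where 'k = 'k and x = z and S = S]
      by simp
    then show ?thesis using assms(8) by blast
  qed
  moreover have "indet ` set Z \<subseteq> LT_ideal \<tau> ?L"
    if \<tau>: "elimination_ordering TYPE('k) (set Z) \<tau>" for \<tau>
  proof
    fix p :: "('x, 'k) mpoly"
    assume "p \<in> indet ` set Z"
    then obtain z where z: "z \<in> set Z" "p = indet z" by blast
    have "K_vs.subspace (Lin_space I)" by (simp add: Lin_space_def)
    \<comment> \<open>The reduction is carried out with \<sigma>, which supplies the triangular
      shape. Its result lies in the space of linear parts, which depends on no ordering, so \<tau>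
      can then be applied to it.\<close>
    from reduced_linear_form [OF this finite_set \<sigma> lin z(1)]
    obtain g where g: "g \<in> Lin_space I" "indet_term z \<in> Poly_Mapping.keys g"
      "Poly_Mapping.keys g \<subseteq> indet_term ` insert z (- set Z)"
      by blast
    have "lead_term \<tau> g = indet_term z"
      using \<tau> z(1) g(2,3) by (rule elimination_lead_term)
    moreover have "g \<noteq> 0" using g(2) by auto
    ultimately show "p \<in> LT_ideal \<tau> ?L"
      unfolding z(2) using g(1) by (intro indet_in_LT_ideal P_mod.span_base)
  qed
  ultimately show ?thesis by blast
qed

end
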